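(* Let $\Sigma$ be a finite alphabet, and let $L=\langle\mathrm{Proc},\Sigma,\to\rangle$ be a labelled transition system that includes the processes of $LTS_F$, the labelled transition system of finite loop-free processes over $\Sigma$. Then $\tau_O\subsetneq\tau_{\mathrm{sim}}$ as topologies on $\mathrm{Proc}$.
   Context: A labelled transition system (LTS) is $\langle \mathrm{Proc},\Sigma,\to\rangle$ with $\to\subseteq \mathrm{Proc}\times\Sigma\times\mathrm{Proc}$. For a process $p$, a finite word $a_1\cdots a_n\in\Sigma^*$ is a finite trace of $p$, written $a_1\cdots a_n\in\mathrm{Trc}(p)$, iff there are processes with $p=p_0\xrightarrow{a_1}p_1\cdots\xrightarrow{a_n}p_n$ (the empty word is always a trace). Finite loop-free processes: $\mathrm{Proc}_F$ is the set of terms generated by $q::=0\mid a.q\mid q+q$ with $a\in\Sigma$. Transitions: $q\xrightarrow{a}_F q'$ iff $q=a.q'$, or $q=q_1+q_2$ and ($q_1\xrightarrow{a}_F q'$ or $q_2\xrightarrow{a}_F q'$); $0$ has no transitions. $LTS_F=\langle\mathrm{Proc}_F,\Sigma,\to_F\rangle$. That $L$ includes the processes of $LTS_F$ means $\mathrm{Proc}_F\subseteq\mathrm{Proc}$, and the transitions in $L$ out of an element of $\mathrm{Proc}_F$ are exactly its $\to_F$-transitions. Simulation: $R\subseteq\mathrm{Proc}_F\times\mathrm{Proc}$ is a simulation if whenever $(q,p)\in R$ and $q\xrightarrow{a}_F q'$, there is $p'\in\mathrm{Proc}$ with $p\xrightarrow{a}p'$ and $(q',p')\in R$. Write $q\sqsubseteq_S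 p$ if $(q,p)\in R$ for some simulation $R$. For $s\in\Sigma^*$, $O(s)=\{p\in\mathrm{Proc}\mid s\in\mathrm{Trc}(p)\}$, and $\tau_O$ is the smallest topology on $\mathrm{Proc}$ containing all $O(s)$, $s\in\Sigma^*$. For $q\in\mathrm{Proc}_F$, $O(q)=\{p\in\mathrm{Proc}\mid q\sqsubseteq_S p\}$, and $\tau_{\mathrm{sim}}$ is the topology on $\mathrm{Proc}$ generated by the basis $\{O(q)\mid q\in\mathrm{Proc}_F\}$.
   Formalization: The alphabet Σ is required to have at least two letters; for an alphabet with at most one letter the two topologies coincide in every labelled transition system, so the strict inclusion fails there. *)

theory Defs
  imports "HOL-Analysis.Analysis"
begin

text \<open>
  The alphabet is a finite type \<open>'a\<close>, the processes of the LTS form a type \<open>'p\<close>, and the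
  transition relation is a curried predicate \<open>tr p a p'\<close>.
\<close>

definition Trc :: "('p \<Rightarrow> 'a \<Rightarrow> 'p \<Rightarrow> bool) \<Rightarrow> 'p \<Rightarrow> 'a list set" where
  "Trc tr p = {s. \<exists>r. r 0 = p \<and> (\<forall>i<length s. tr (r i) (s ! i) (r (Suc i)))}"

datatype 'a procF = Nil0 | Pre 'a "'a procF" | Plus "'a procF" "'a procF"

primrec stepF :: "'a procF \<Rightarrow> 'a \<Rightarrow> 'a procF \<Rightarrow> bool" where
  "stepF Nil0 a q' \<longleftrightarrow> False"
| "stepF (Pre b q) a q' \<longleftrightarrow> a = b \<and> q' = q"
| "stepF (Plus q1 q2) a q' \<longleftrightarrow> stepF q1 a q' \<or> stepF q2 a q'"

text \<open>
  The inclusion of the finite loop-free processes into the processes of the LTS is an injection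
  \<open>emb\<close>. Only the transitions leaving an embedded process are constrained, and these are
  exactly the images of the transitions of \<open>stepF\<close>; other processes may well have
  transitions into the image of \<open>emb\<close>.
\<close>

definition includes_LTSF :: "('p \<Rightarrow> 'a \<Rightarrow> 'p \<Rightarrow> bool) \<Rightarrow> ('a procF \<Rightarrow> 'p) \<Rightarrow> bool" where
  "includes_LTSF tr emb \<longleftrightarrow>
     inj emb \<and> (\<forall>q a p'. tr (emb q) a p' \<longleftrightarrow> (\<exists>q'. stepF q a q' \<and> p' = emb q'))"

definition simulation :: "('p \<Rightarrow> 'a \<Rightarrow> 'p \<Rightarrow> bool) \<Rightarrow> ('a procF \<times> 'p) set \<Rightarrow> bool" where
  "simulation tr R \<longleftrightarrow>
     (\<forall>q p a q'. (q, p) \<in> R \<and> stepF q a q' \<longrightarrow> (\<exists>p'. tr p a p' \<and> (q', p') \<in> R))"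

definition simulated_by :: "('p \<Rightarrow> 'a \<Rightarrow> 'p \<Rightarrow> bool) \<Rightarrow> 'a procF \<Rightarrow> 'p \<Rightarrow> bool" where
  "simulated_by tr q p \<longleftrightarrow> (\<exists>R. simulation tr R \<and> (q, p) \<in> R)"

definition O_trace :: "('p \<Rightarrow> 'a \<Rightarrow> 'p \<Rightarrow> bool) \<Rightarrow> 'a list \<Rightarrow> 'p set" where
  "O_trace tr s = {p. s \<in> Trc tr p}"

definition O_sim :: "('p \<Rightarrow> 'a \<Rightarrow> 'p \<Rightarrow> bool) \<Rightarrow> 'a procF \<Rightarrow> 'p set" where
  "O_sim tr q = {p. simulated_by tr q p}"

definition tau_O :: "('p \<Rightarrow> 'a \<Rightarrow> 'p \<Rightarrow> bool) \<Rightarrow> 'p topology" where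
  "tau_O tr = topology_generated_by (range (O_trace tr))"

text \<open>
  The open sets are the unions of basic open sets; \<open>openin_tau_sim\<close> below confirms that the
  family of all \<open>O_sim tr q\<close> is indeed a basis of a topology.

  Over a one-letter alphabet, \<open>q\<close> is simulated by \<open>p\<close> as soon as \<open>p\<close> has a trace as long
  as the depth of \<open>q\<close>, so there \<open>tau_sim\<close> equals \<open>tau_O\<close>; strict inclusion between
  the two topologies needs at least two letters.
\<close>

definition tau_sim :: "('p \<Rightarrow> 'a \<Rightarrow> 'p \<Rightarrow> bool) \<Rightarrow> 'p topology" where
  "tau_sim tr = topology (arbitrary union_of (\<lambda>U. U \<in> range (O_sim tr)))"

lemma O_sim_Nil0: "O_sim tr Nil0 = UNIV"
proof -
  have "simulation tr ({Nil0} \<times> UNIV)"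
    by (auto simp: simulation_def)
  then show ?thesis
    by (auto simp: O_sim_def simulated_by_def)
qed

lemma simulated_by_step:
  assumes "simulated_by tr q p" "stepF q a q'"
  shows "\<exists>p'. tr p a p' \<and> simulated_by tr q' p'"
  using assms unfolding simulated_by_def simulation_def by metis

lemma simulated_byI:
  assumes "\<And>a q'. stepF q a q' \<Longrightarrow> \<exists>p'. tr p a p' \<and> simulated_by tr q' p'"
  shows "simulated_by tr q p"
proof -
  have "simulation tr (insert (q, p) {(q, p). simulated_by tr q p})"
    using assms simulated_by_step[of tr] unfolding simulation_def by blast
  then show ?thesis
    unfolding simulated_by_def by blast
qed

lemma O_sim_Plus: "O_sim tr (Plus q1 q2) = O_sim tr q1 \<inter> O_sim tr q2"
proof (intro set_eqI)
  fix p
  have "simulated_by tr (Plus q1 q2) p \<longleftrightarrow> simulated_by tr q1 p \<and> simulated_by tr q2 p"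
    using simulated_by_step[of tr] by (auto 0 4 intro!: simulated_byI)
  then show "p \<in> O_sim tr (Plus q1 q2) \<longleftrightarrow> p \<in> O_sim tr q1 \<inter> O_sim tr q2"
    by (simp add: O_sim_def)
qed

lemma openin_tau_sim: "openin (tau_sim tr) U \<longleftrightarrow> (\<exists>Q. U = (\<Union>q\<in>Q. O_sim tr q))"
proof -
  have "istopology (arbitrary union_of (\<lambda>U. U \<in> range (O_sim tr)))"
    by (rule istopology_base) (auto simp: O_sim_Plus[symmetric])
  then have "openin (tau_sim tr) U \<longleftrightarrow> (arbitrary union_of (\<lambda>U. U \<in> range (O_sim tr))) U"
    by (simp add: tau_sim_def topology_inverse')
  also have "\<dots> \<longleftrightarrow> (\<exists>\<U>. \<U> \<subseteq> range (O_sim tr) \<and> \<Union>\<U> = U)"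
    by (auto simp: union_of_def arbitrary_def)
  also have "\<dots> \<longleftrightarrow> (\<exists>Q. U = (\<Union>q\<in>Q. O_sim tr q))"
    by (metis subset_image_iff subset_UNIV)
  finally show ?thesis .
qed

lemma topspace_tau_O: "topspace (tau_O tr) = UNIV"
proof -
  have "O_trace tr [] = UNIV"
    by (auto simp: O_trace_def Trc_def)
  then show ?thesis
    by (auto simp: tau_O_def topology_generated_by_topspace)
qed

lemma topspace_tau_sim: "topspace (tau_sim tr) = UNIV"
proof -
  have "openin (tau_sim tr) UNIV"
    unfolding openin_tau_sim by (rule exI[of _ "{Nil0}"]) (simp add: O_sim_Nil0)
  then show ?thesis
    using openin_subset by blast
qed

end

theory Submission
  imports Defs
begin

text \<open>
  Prefixing every letter of a word turns it into a process that is simulated by exactly the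
  processes having the word as a trace, so every \<open>O_trace tr s\<close> is a basic open set of
  \<open>tau_sim tr\<close>. On the other hand, open sets of \<open>tau_O tr\<close> are closed under
  enlarging the set of traces, and \<open>a.(q + r)\<close> has the same traces as \<open>a.q + a.r\<close>. For
  letters \<open>a \<noteq> b\<close> the process \<open>a.(a.0 + b.0)\<close> is not simulated by
  \<open>a.a.0 + a.b.0\<close>, hence its basic open set is not open in \<open>tau_O tr\<close>.
\<close>

lemma Nil_in_Trc [simp]: "[] \<in> Trc tr p"
  by (auto simp: Trc_def)

lemma Cons_in_Trc [simp]: "a # s \<in> Trc tr p \<longleftrightarrow> (\<exists>p'. tr p a p' \<and> s \<in> Trc tr p')"
proof
  assume "a # s \<in> Trc tr p"
  then obtain r where r: "r 0 = p" "\<forall>i<length (a # s). tr (r i) ((a # s) ! i) (r (Suc i))"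
    by (auto simp: Trc_def)
  then have "tr p a (r 1)"
    by auto
  moreover from r have "s \<in> Trc tr (r 1)"
    unfolding Trc_def by (auto intro!: exI[of _ "\<lambda>i. r (Suc i)"])
  ultimately show "\<exists>p'. tr p a p' \<and> s \<in> Trc tr p'"
    by blast
next
  assume "\<exists>p'. tr p a p' \<and> s \<in> Trc tr p'"
  then obtain r where "tr p a (r 0)" "\<forall>i<length s. tr (r i) (s ! i) (r (Suc i))"
    by (auto simp: Trc_def)
  then show "a # s \<in> Trc tr p"
    unfolding Trc_def
    \<comment> \<open>The run for \<open>a # s\<close> visits \<open>p\<close> at index 0 and then
      follows \<open>r\<close> with indices shifted by one.\<close>
    by (auto simp: less_Suc_eq_0_disj intro!: exI[of _ "\<lambda>i. case i of 0 \<Rightarrow> p | Suc j \<Rightarrow> r j"])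
qed

lemma simulated_by_Nil0 [simp]: "simulated_by tr Nil0 p"
  by (rule simulated_byI) simp

lemma simulated_by_Pre [simp]:
  "simulated_by tr (Pre a q) p \<longleftrightarrow> (\<exists>p'. tr p a p' \<and> simulated_by tr q p')"
proof
  show "\<exists>p'. tr p a p' \<and> simulated_by tr q p'" if "simulated_by tr (Pre a q) p"
    using simulated_by_step[OF that, of a q] by simp
  show "simulated_by tr (Pre a q) p" if "\<exists>p'. tr p a p' \<and> simulated_by tr q p'"
    using that by (intro simulated_byI) simp
qed

lemma simulated_by_Plus [simp]:
  "simulated_by tr (Plus q r) p \<longleftrightarrow> simulated_by tr q p \<and> simulated_by tr r p"
  using O_sim_Plus[of tr q r] by (auto simp: O_sim_def)

text \<open>Both sides unfold along \<open>s\<close> to the same one-step condition.\<close>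

lemma simulated_by_foldr_Pre: "simulated_by tr (foldr Pre s Nil0) p \<longleftrightarrow> s \<in> Trc tr p"
  by (induction s arbitrary: p) auto

lemma O_trace_eq_O_sim: "O_trace tr s = O_sim tr (foldr Pre s Nil0)"
  by (simp add: O_trace_def O_sim_def simulated_by_foldr_Pre)

lemma openin_tau_sim_O_sim: "openin (tau_sim tr) (O_sim tr q)"
  unfolding openin_tau_sim by (rule exI[of _ "{q}"]) simp

lemma openin_tau_O_imp_tau_sim:
  assumes "openin (tau_O tr) U"
  shows "openin (tau_sim tr) U"
proof (rule generate_topology_on_coarsest)
  show "generate_topology_on (range (O_trace tr)) U"
    using assms by (simp add: tau_O_def openin_topology_generated_by_iff)
  show "openin (tau_sim tr) V" if "V \<in> range (O_trace tr)" for V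
    using that by (auto simp: O_trace_eq_O_sim openin_tau_sim_O_sim)
qed (rule istopology_openin)

text \<open>Passing from \<open>p\<close> to \<open>p'\<close> preserves membership in each
  generator \<open>O_trace tr s\<close>, and this property survives finite intersections and
  arbitrary unions.\<close>

lemma openin_tau_O_Trc_mono:
  assumes "openin (tau_O tr) U" "p \<in> U" "Trc tr p \<subseteq> Trc tr p'"
  shows "p' \<in> U"
proof -
  have "generate_topology_on (range (O_trace tr)) U"
    using assms(1) by (simp add: tau_O_def openin_topology_generated_by_iff)
  then show ?thesis
    using assms(2,3) by induction (auto simp: O_trace_def)
qed

lemma includes_LTSF_step:
  "includes_LTSF tr emb \<Longrightarrow> tr (emb q) a p' \<longleftrightarrow> (\<exists>q'. stepF q a q' \<and> p' = emb q')"
  by (simp add: includes_LTSF_def)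

text \<open>After the first \<open>a\<close>, either process continues with a trace of
  \<open>q\<close> or of \<open>r\<close>; traces do not record when that choice is made.\<close>

lemma Trc_Pre_Plus:
  assumes "includes_LTSF tr emb"
  shows "Trc tr (emb (Pre a (Plus q r))) = Trc tr (emb (Plus (Pre a q) (Pre a r)))"
proof (rule set_eqI)
  fix s
  have Plus: "t \<in> Trc tr (emb (Plus q r)) \<longleftrightarrow> t \<in> Trc tr (emb q) \<or> t \<in> Trc tr (emb r)" for t
    by (cases t) (auto simp: includes_LTSF_step[OF assms])
  show "s \<in> Trc tr (emb (Pre a (Plus q r))) \<longleftrightarrow> s \<in> Trc tr (emb (Plus (Pre a q) (Pre a r)))"
    by (cases s) (auto simp: includes_LTSF_step[OF assms] Plus)
qed

lemma simulated_by_refl: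
  assumes "includes_LTSF tr emb"
  shows "simulated_by tr q (emb q)"
proof -
  have "simulation tr {(q, emb q) | q. True}"
    by (auto simp: simulation_def includes_LTSF_step[OF assms])
  then show ?thesis
    unfolding simulated_by_def by blast
qed

theorem corollary4p12:
  fixes tr :: "'p \<Rightarrow> 'a::finite \<Rightarrow> 'p \<Rightarrow> bool"
    and emb :: "'a procF \<Rightarrow> 'p"
  assumes "2 \<le> CARD('a)"
    and "includes_LTSF tr emb"
  shows "{U. openin (tau_O tr) U} \<subset> {U. openin (tau_sim tr) U}"
proof -
  obtain a b :: 'a where "a \<noteq> b"
    using ex_card[OF assms(1)] by (auto simp: card_2_iff)
  define q r where "q = Pre a (Nil0 :: 'a procF)" and "r = Pre b (Nil0 :: 'a procF)"
  let ?U = "O_sim tr (Pre a (Plus q r))"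
  have "emb (Pre a (Plus q r)) \<in> ?U"
    unfolding O_sim_def using simulated_by_refl[OF assms(2)] by blast
  moreover have "emb (Plus (Pre a q) (Pre a r)) \<notin> ?U"
  proof
    assume "emb (Plus (Pre a q) (Pre a r)) \<in> ?U"
    \<comment> \<open>A single \<open>a\<close>-successor must simulate both \<open>q\<close> and
      \<open>r\<close>.\<close>
    then obtain p where "tr (emb (Plus (Pre a q) (Pre a r))) a p"
      and p: "simulated_by tr q p" "simulated_by tr r p"
      by (auto simp: O_sim_def)
    then have "p = emb q \<or> p = emb r"
      by (simp add: includes_LTSF_step[OF assms(2)]) blast
    \<comment> \<open>\<open>emb q\<close> has no \<open>b\<close>-step, so it cannot simulate
      \<open>r\<close>; \<open>emb r\<close> has no \<open>a\<close>-step, so it cannot simulate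
      \<open>q\<close>.\<close>
    with p \<open>a \<noteq> b\<close> show False
      by (elim disjE) (simp_all add: q_def r_def includes_LTSF_step[OF assms(2)])
  qed
  ultimately have "\<not> openin (tau_O tr) ?U"
    using openin_tau_O_Trc_mono[OF _ _ equalityD1[OF Trc_Pre_Plus[OF assms(2)]]] by metis
  then show ?thesis
    using openin_tau_O_imp_tau_sim openin_tau_sim_O_sim by blast
qed

end
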